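(* Let $s\ge 3$ and let ${}^{i}a\in\Sigma^{s}$ with $a\neq 0$ and $i\in D\setminus\{0\}$. Then the equation $$x\oplus {}^{i}a={}^{0}0$$ has exactly $s-1$ distinct solutions $x\in\Sigma^{s}$, namely $x={}^{j}a$ for every $j\in D\setminus\{0\}$ with $j\neq i$.
   Context: **Magnitudes.** $P$ is a non-empty set with two binary operations $+$ and $\cdot$ such that: $(P,+)$ is a commutative monoid with identity $0$; $(P\setminus\{0\},\cdot)$ is an abelian group (its identity is written $1$); and $\cdot$ distributes over $+$ on both sides. Moreover $(P,+,\le)$ is a totally ordered (with translation-invariant order) cancellative commutative monoid, such that whenever $a\ge b$ there is a unique $c\in P$ with $b+c=a$, denoted $a-b$. Finally, $P$ has no nonzero additive inverses: if $a,b\in P$ and $a+b=0$ then $a=b=0$. **Multisign set.** Fix an integer $s\ge 1$ and let $D=\{0,1,\dots,s\}$. The set $\Sigma^{s}$ consists of formal pairs ${}^{d}p$ with sign $d\in D$ and magnitude $p\in P$, where the sign $0$ is reserved for the element ${}^{0}0$, and ${}^{0}0$ is the only element with magnitude $0$. Thus $\Sigma^{s}=\{{}^{0}0\}\cup\{{}^{d}p: d\in\{1,\dots,s\},\ p\in P\setminus\{0\}\}$. **Addition.** For ${}^{i}a,{}^{j}b\in\Sigma^{s}$: $${}^{i}a\oplus{}^{j}b=\begin{cases}{}^{i}(a+b)&\text{if } i=j,\\ {}^{i}(a-b)&\text{if } i\ne j,\ a>b,\\ {}^{j}(b-a)&\text{if } i\neq j,\ a<b,\\ {}^{0}0&\text{if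 } i\ne j,\ a=b.\end{cases}$$ *)

theory Defs
  imports Main
begin

text \<open>
  The structure on the set of magnitudes. The group axioms for multiplication are only required
  on the nonzero magnitudes, and subtraction is not a primitive operation.
\<close>

class magnitudes = ordered_comm_monoid_add + linorder + cancel_semigroup_add + times + one +
  assumes mult_nonzero: "a \<noteq> 0 \<Longrightarrow> b \<noteq> 0 \<Longrightarrow> a * b \<noteq> 0"
    and mult_assoc_nonzero:
      "a \<noteq> 0 \<Longrightarrow> b \<noteq> 0 \<Longrightarrow> c \<noteq> 0 \<Longrightarrow> (a * b) * c = a * (b * c)"
    and mult_commute_nonzero: "a \<noteq> 0 \<Longrightarrow> b \<noteq> 0 \<Longrightarrow> a * b = b * a"
    and one_nonzero: "1 \<noteq> 0"
    and mult_one_nonzero: "a \<noteq> 0 \<Longrightarrow> 1 * a = a"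
    and mult_inverse_nonzero: "a \<noteq> 0 \<Longrightarrow> \<exists>b. b \<noteq> 0 \<and> b * a = 1"
    and mult_add_left: "a * (b + c) = a * b + a * c"
    and mult_add_right: "(a + b) * c = a * c + b * c"
    and ex1_difference: "b \<le> a \<Longrightarrow> \<exists>!c. b + c = a"
    and no_additive_inverses: "a + b = 0 \<Longrightarrow> a = 0 \<and> b = 0"

text \<open>Only meaningful for \<open>b \<le> a\<close>.\<close>

definition mag_diff :: "'p::magnitudes \<Rightarrow> 'p \<Rightarrow> 'p" where
  "mag_diff a b = (THE c. b + c = a)"

definition signs :: "nat \<Rightarrow> nat set" where
  "signs s = {0..s}"

text \<open>The element with sign \<open>d\<close> and magnitude \<open>p\<close> is encoded as the pair \<open>(d, p)\<close>.\<close>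

definition multisign :: "nat \<Rightarrow> (nat \<times> 'p::magnitudes) set" where
  "multisign s = {(0, 0)} \<union> {(d, p) | d p. d \<in> signs s - {0} \<and> p \<noteq> 0}"

text \<open>
  The formula for the sum does not mention \<open>s\<close>, so a single function on pairs serves as the
  addition of every \<open>multisign s\<close>; only its values on \<open>multisign s\<close> are meaningful.
\<close>

fun msum :: "nat \<times> 'p::magnitudes \<Rightarrow> nat \<times> 'p \<Rightarrow> nat \<times> 'p" (infixl "\<oplus>" 65) where
  "(i, a) \<oplus> (j, b) =
    (if i = j then (i, a + b)
     else if a > b then (i, mag_diff a b)
     else if a < b then (j, mag_diff b a)
     else (0, 0))"

end

theory Submission
  imports Defs
begin

text \<open>A sum of equal nonzero signs keeps that sign; unequal signs cancel exactly when the
  magnitudes agree (\<open>msum_eq_zero_iff\<close>). So a solution carries \<open>a\<close> under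
  one of the s - 1 other nonzero signs.\<close>

lemma mag_diff_eq_0_iff:
  fixes a b :: "'p::magnitudes"
  assumes "b \<le> a"
  shows "mag_diff a b = 0 \<longleftrightarrow> a = b"
proof -
  have "b + mag_diff a b = a"
    unfolding mag_diff_def by (rule theI') (rule ex1_difference[OF assms])
  then show ?thesis
    by (metis add.right_neutral add_left_cancel)
qed

text \<open>As \<open>(j, b)\<close> is any pair, \<open>j = 0\<close> with \<open>b > a\<close> can
  occur: the sum then has sign 0, and only its nonzero difference keeps it from being
  \<open>(0, 0)\<close>.\<close>

lemma msum_eq_zero_iff:
  fixes a b :: "'p::magnitudes"
  assumes "i \<noteq> 0"
  shows "(j, b) \<oplus> (i, a) = (0, 0) \<longleftrightarrow> j \<noteq> i \<and> b = a"
  using assms mag_diff_eq_0_iff[of a b] by auto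

theorem proposition3p16:
  fixes s i :: nat and a :: "'p::magnitudes"
  assumes "s \<ge> 3"
    and "(i, a) \<in> multisign s"
    and "a \<noteq> 0"
    and "i \<in> signs s - {0}"
  shows "{x \<in> multisign s. x \<oplus> (i, a) = (0, 0)} = {(j, a) | j. j \<in> signs s - {0} \<and> j \<noteq> i}
    \<and> card {x \<in> multisign s. x \<oplus> (i, a) = (0, 0)} = s - 1"
proof -
  have solutions: "{x \<in> multisign s. x \<oplus> (i, a) = (0, 0)} =
      {(j, a) | j. j \<in> signs s - {0} \<and> j \<noteq> i}"
    \<comment> \<open>\<open>a \<noteq> 0\<close> rules out the solution candidate
      \<open>(0, 0)\<close> and puts each \<open>(j, a)\<close> in
      \<open>multisign s\<close>.\<close>
    using assms(3,4) by (auto simp: msum_eq_zero_iff multisign_def simp del: msum.simps)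
  also have "\<dots> = (\<lambda>j. (j, a)) ` ({1..s} - {i})"
    by (auto simp: signs_def)
  \<comment> \<open>The map is injective, and \<open>i\<close> is one of the s nonzero signs
    removed.\<close>
  also have "card \<dots> = s - 1"
    using assms(4) by (subst card_image) (auto simp: inj_on_def signs_def)
  finally show ?thesis
    using solutions by simp
qed

end
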